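(* Let $n\ge 4$, let $\lambda_3,\dots,\lambda_{n-1}\in\mathbb{R}$, $\alpha\le 0$ and $\beta>0$, and let $g_{\mathbb{R}^n}$ be the Lorentzian metric on $\mathbb{R}^n$ given by $$g_{\mathbb{R}^n} = e^{-2\alpha x_{n}}\left[\cos(2\beta x_{n})(-dx_{1}^{2} + dx_{2}^{2}) - 2\sin(2\beta x_{n})\,dx_{1} dx_{2}\right] + \sum_{i = 3}^{n-1} e^{-2\lambda_{i} x_{n}} dx_{i}^{2} + dx_{n}^{2},$$ where $x_1,\dots,x_n$ are the canonical coordinates. Then the homogeneous Lorentzian manifold $(\mathbb{R}^n,g_{\mathbb{R}^n})$ is totally vicious.
   Context: A Lorentzian manifold $(M,g_M)$ is totally vicious if every point of $M$ lies on a closed timelike curve, i.e. a smooth closed curve $c$ with $g_M(c'(t),c'(t))<0$ for all $t$. No Ricci-flatness or further relation among the parameters is assumed. *)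

theory Defs
  imports "HOL-Analysis.Analysis"
begin

text \<open>
  Maps of class \<open>C\<^sup>k\<close> between normed spaces, by recursion on directional derivatives. Between
  finite-dimensional spaces this is the usual notion (all partial derivatives up to
  order \<open>k\<close> exist and are continuous). For a curve \<open>c\<close> on the reals, the directional derivative
  along \<open>v\<close> is \<open>v\<close> times the velocity of \<open>c\<close>.
\<close>

primrec Ck_map :: "nat \<Rightarrow> ('a::real_normed_vector \<Rightarrow> 'b::real_normed_vector) \<Rightarrow> bool" where
  "Ck_map 0 f \<longleftrightarrow> continuous_on UNIV f"
| "Ck_map (Suc k) f \<longleftrightarrow>
     (\<forall>x. f differentiable (at x)) \<and> (\<forall>v. Ck_map k (\<lambda>x. frechet_derivative f (at x) v))"

definition smooth_map :: "('a::real_normed_vector \<Rightarrow> 'b::real_normed_vector) \<Rightarrow> bool" where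
  "smooth_map f \<longleftrightarrow> (\<forall>k. Ck_map k f)"

text \<open>
  A field of bilinear forms on the manifold \<open>real ^ 'n\<close>: \<open>g x u v\<close> is the value at the point \<open>x\<close>
  on the tangent vectors \<open>u\<close>, \<open>v\<close>, each tangent space being identified with \<open>real ^ 'n\<close>.
\<close>

type_synonym 'n tensor2 = "real ^ 'n \<Rightarrow> real ^ 'n \<Rightarrow> real ^ 'n \<Rightarrow> real"

text \<open>
  Signature \<open>(-, +, \<dots>, +)\<close> is expressed by a pseudo-orthonormal frame at each point; the
  Gram matrix makes the \<open>CARD('n)\<close> vectors of the frame automatically a basis.
\<close>

definition lorentzian_metric :: "'n::finite tensor2 \<Rightarrow> bool" where
  "lorentzian_metric g \<longleftrightarrow>
     (\<forall>u v. smooth_map (\<lambda>x. g x u v)) \<and>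
     (\<forall>x. bilinear (g x)) \<and>
     (\<forall>x u v. g x u v = g x v u) \<and>
     (\<forall>x. \<exists>(b :: 'n \<Rightarrow> real ^ 'n) i\<^sub>0. \<forall>i j.
        g x (b i) (b j) = (if i = j then (if i = i\<^sub>0 then -1 else 1) else 0))"

definition metric_isometry :: "'n::finite tensor2 \<Rightarrow> (real ^ 'n \<Rightarrow> real ^ 'n) \<Rightarrow> bool" where
  "metric_isometry g \<phi> \<longleftrightarrow>
     bij \<phi> \<and> smooth_map \<phi> \<and> smooth_map (inv \<phi>) \<and>
     (\<forall>x u v. g (\<phi> x) (frechet_derivative \<phi> (at x) u) (frechet_derivative \<phi> (at x) v) = g x u v)"

definition homogeneous_metric :: "'n::finite tensor2 \<Rightarrow> bool" where
  "homogeneous_metric g \<longleftrightarrow> (\<forall>p q. \<exists>\<phi>. metric_isometry g \<phi> \<and> \<phi> p = q)"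

text \<open>
  Smooth closed curves are smooth maps from the circle, i.e. smooth periodic maps from the
  reals; in particular the curve has no corner at the point where it closes up.
\<close>

definition closed_timelike_curve :: "'n::finite tensor2 \<Rightarrow> (real \<Rightarrow> real ^ 'n) \<Rightarrow> bool" where
  "closed_timelike_curve g c \<longleftrightarrow>
     smooth_map c \<and> (\<exists>T>0. \<forall>t. c (t + T) = c t) \<and>
     (\<forall>t. g (c t) (vector_derivative c (at t)) (vector_derivative c (at t)) < 0)"

definition totally_vicious :: "'n::finite tensor2 \<Rightarrow> bool" where
  "totally_vicious g \<longleftrightarrow> (\<forall>p. \<exists>c. closed_timelike_curve g c \<and> p \<in> range c)"

text \<open>
  The map \<open>e\<close> enumerates the index type, so that the \<open>k\<close>-th canonical coordinate of \<open>x\<close>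
  is \<open>x $ e k\<close> for \<open>k = 1, \<dots>, CARD('n)\<close>. The bilinear form is the polarisation of the
  line element; \<open>dx\<^sub>1 dx\<^sub>2\<close> is the symmetric product
  \<open>(dx\<^sub>1 \<otimes> dx\<^sub>2 + dx\<^sub>2 \<otimes> dx\<^sub>1) / 2\<close>.
\<close>

definition g_Rn :: "(nat \<Rightarrow> 'n) \<Rightarrow> (nat \<Rightarrow> real) \<Rightarrow> real \<Rightarrow> real \<Rightarrow> 'n::finite tensor2" where
  "g_Rn e lam \<alpha> \<beta> x u v =
     (let n = CARD('n); x\<^sub>n = x $ e n in
      exp (-2 * \<alpha> * x\<^sub>n) *
        (cos (2 * \<beta> * x\<^sub>n) * (- (u $ e 1 * v $ e 1) + u $ e 2 * v $ e 2)
         - sin (2 * \<beta> * x\<^sub>n) * (u $ e 1 * v $ e 2 + u $ e 2 * v $ e 1))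
      + (\<Sum>i = 3..n - 1. exp (-2 * lam i * x\<^sub>n) * (u $ e i * v $ e i))
      + u $ e n * v $ e n)"

lemma g_Rn_line_element:
  fixes x v :: "real ^ 'n::finite"
  assumes "n = CARD('n)"
  shows "g_Rn e lam \<alpha> \<beta> x v v =
     exp (-2 * \<alpha> * x $ e n) *
       (cos (2 * \<beta> * x $ e n) * (- (v $ e 1)\<^sup>2 + (v $ e 2)\<^sup>2)
        - 2 * sin (2 * \<beta> * x $ e n) * (v $ e 1) * (v $ e 2))
     + (\<Sum>i = 3..n - 1. exp (-2 * lam i * x $ e n) * (v $ e i)\<^sup>2)
     + (v $ e n)\<^sup>2"
  unfolding g_Rn_def Let_def assms by (simp add: power2_eq_square algebra_simps)

end

theory Submission
  imports Defs
begin

text \<open>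
  Write \<open>z = x\<^sub>1 + i x\<^sub>2\<close> and \<open>t = x\<^sub>n\<close>. The first summand of the metric is
  \<open>- Re (e\<^bsup>-2(\<alpha> + i\<beta>)t\<^esup> dz\<^sup>2)\<close>, so the maps
  \<open>z \<mapsto> e\<^bsup>(\<alpha> + i\<beta>)s\<^esup> z\<close>, \<open>x\<^sub>i \<mapsto> e\<^bsup>\<lambda>\<^sub>i s\<^esup> x\<^sub>i\<close>, \<open>t \<mapsto> t + s\<close> composed with
  translations of the other coordinates are a transitive group of affine isometries. Hence one
  closed timelike curve suffices. A curve with \<open>z' = r e\<^bsup>i\<beta>t\<^esup>\<close> is timelike once \<open>r > 0\<close> is
  large compared with \<open>t'\<close>. Setting \<open>w = tan (\<beta>t/2)\<close> and \<open>r = k (1 + w\<^sup>2)\<close> gives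
  \<open>z' = k (1 + i w)\<^sup>2\<close>, and for \<open>w = sqrt 2 cos s\<close> this has mean zero over a period, so that
  \<open>z\<close> closes up to a figure eight.
\<close>

section \<open>Smooth maps\<close>

text \<open>\<open>frechet_derivative\<close> is a choice term. Uniqueness of the derivative lets
  any explicit formula stand in for it, so that the inductions below can run on the product and
  chain rules.\<close>

lemma Ck_map_SucI:
  assumes "\<And>x. (f has_derivative f' x) (at x)" and "\<And>v. Ck_map k (\<lambda>x. f' x v)"
  shows "Ck_map (Suc k) f"
proof -
  have "frechet_derivative f (at x) = f' x" for x
    using frechet_derivative_at[OF assms(1)] by simp
  then show ?thesis
    using assms by (auto simp: differentiable_def)
qed

lemma Ck_map_has_derivative:
  assumes "Ck_map (Suc k) f"
  shows "(f has_derivative frechet_derivative f (at x)) (at x)"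
  using assms frechet_derivative_works by auto

text \<open>Product and chain rules keep undifferentiated factors, which are then needed one order
  lower. The base case is that differentiability implies continuity.\<close>

lemma Ck_map_SucD: "Ck_map (Suc k) f \<Longrightarrow> Ck_map k f"
proof (induction k arbitrary: f)
  case 0
  then show ?case
    by (auto intro!: differentiable_imp_continuous_on simp: differentiable_on_def)
next
  case (Suc k)
  then show ?case by (metis Ck_map.simps(2))
qed

lemma Ck_map_const: "Ck_map k (\<lambda>x. c)"
proof (induction k arbitrary: c)
  case (Suc k)
  then show ?case by (auto intro!: Ck_map_SucI derivative_eq_intros)
qed simp

lemma Ck_map_bounded_linear:
  assumes "bounded_linear L"
  shows "Ck_map k L"
proof (cases k)
  case 0
  then show ?thesis using assms by (simp add: linear_continuous_on)
next
  case (Suc m)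
  show ?thesis
    unfolding Suc
    by (rule Ck_map_SucI[OF bounded_linear_imp_has_derivative[OF assms] Ck_map_const])
qed

lemma Ck_map_add: "Ck_map k f \<Longrightarrow> Ck_map k g \<Longrightarrow> Ck_map k (\<lambda>x. f x + g x)"
proof (induction k arbitrary: f g)
  case 0
  then show ?case by (simp add: continuous_on_add)
next
  case (Suc k)
  show ?case
  proof (rule Ck_map_SucI)
    show "((\<lambda>x. f x + g x) has_derivative
        (\<lambda>v. frechet_derivative f (at x) v + frechet_derivative g (at x) v)) (at x)" for x
      by (intro has_derivative_add Ck_map_has_derivative[OF Suc.prems(1)]
        Ck_map_has_derivative[OF Suc.prems(2)])
    show "Ck_map k (\<lambda>x. frechet_derivative f (at x) v + frechet_derivative g (at x) v)" for v
      using Suc by simp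
  qed
qed

lemma Ck_map_bilinear:
  assumes "bounded_bilinear b"
  shows "Ck_map k f \<Longrightarrow> Ck_map k g \<Longrightarrow> Ck_map k (\<lambda>x. b (f x) (g x))"
proof (induction k arbitrary: f g)
  case 0
  then show ?case by (simp add: bounded_bilinear.continuous_on[OF assms])
next
  case (Suc k)
  show ?case
  proof (rule Ck_map_SucI)
    show "((\<lambda>x. b (f x) (g x)) has_derivative
        (\<lambda>v. b (f x) (frechet_derivative g (at x) v) + b (frechet_derivative f (at x) v) (g x)))
        (at x)" for x
      by (intro bounded_bilinear.FDERIV[OF assms] Ck_map_has_derivative[OF Suc.prems(1)]
        Ck_map_has_derivative[OF Suc.prems(2)])
    show "Ck_map k (\<lambda>x. b (f x) (frechet_derivative g (at x) v)
        + b (frechet_derivative f (at x) v) (g x))" for v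
      using Suc.prems Ck_map_SucD[OF Suc.prems(1)] Ck_map_SucD[OF Suc.prems(2)]
      by (intro Ck_map_add Suc.IH) auto
  qed
qed

text \<open>With a real outer function the chain rule yields a product of \<open>h'\<close> at
  \<open>f x\<close> and a directional derivative of \<open>f\<close>. The bilinear lemma and the
  induction hypothesis for \<open>h'\<close> then apply.\<close>

lemma Ck_map_compose_real:
  fixes h :: "real \<Rightarrow> real"
  shows "Ck_map k h \<Longrightarrow> Ck_map k f \<Longrightarrow> Ck_map k (\<lambda>x. h (f x))"
proof (induction k arbitrary: h f)
  case 0
  then show ?case using continuous_on_compose2 by fastforce
next
  case (Suc k)
  let ?h' = "\<lambda>y. frechet_derivative h (at y) 1"
  show ?case
  proof (rule Ck_map_SucI)
    fix x
    have "(h has_derivative (\<lambda>v. v * ?h' (f x))) (at (f x))"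
    proof -
      have hd: "(h has_derivative frechet_derivative h (at (f x))) (at (f x))"
        by (rule Ck_map_has_derivative[OF Suc.prems(1)])
      have "frechet_derivative h (at (f x)) v = v * ?h' (f x)" for v
        using linear_cmul[OF has_derivative_linear[OF hd], of v 1] by simp
      then show ?thesis using hd by (metis (no_types, lifting) ext)
    qed
    from has_derivative_compose[OF Ck_map_has_derivative[OF Suc.prems(2)] this]
    show "((\<lambda>x. h (f x)) has_derivative (\<lambda>v. frechet_derivative f (at x) v * ?h' (f x))) (at x)" .
  next
    fix v
    show "Ck_map k (\<lambda>x. frechet_derivative f (at x) v * ?h' (f x))"
      using Suc.prems Ck_map_SucD[OF Suc.prems(2)]
      by (intro Ck_map_bilinear[OF bounded_bilinear_mult] Suc.IH[of ?h' f]) auto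
  qed
qed

lemma Ck_map_SucI_real:
  fixes h h' :: "real \<Rightarrow> real"
  assumes "\<And>x. (h has_real_derivative h' x) (at x)" and "Ck_map k h'"
  shows "Ck_map (Suc k) h"
proof (rule Ck_map_SucI)
  show "(h has_derivative (\<lambda>v. h' x * v)) (at x)" for x
    using assms(1) by (simp add: has_field_derivative_def)
  show "Ck_map k (\<lambda>x. h' x * v)" for v
    by (intro Ck_map_bilinear[OF bounded_bilinear_mult] Ck_map_const assms(2))
qed

lemma smooth_map_const: "smooth_map (\<lambda>x. c)"
  by (simp add: smooth_map_def Ck_map_const)

lemma smooth_map_bounded_linear: "bounded_linear L \<Longrightarrow> smooth_map L"
  by (simp add: smooth_map_def Ck_map_bounded_linear)

lemma smooth_map_add: "smooth_map f \<Longrightarrow> smooth_map g \<Longrightarrow> smooth_map (\<lambda>x. f x + g x)"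
  by (simp add: smooth_map_def Ck_map_add)

lemma smooth_map_bilinear:
  "bounded_bilinear b \<Longrightarrow> smooth_map f \<Longrightarrow> smooth_map g \<Longrightarrow> smooth_map (\<lambda>x. b (f x) (g x))"
  by (simp add: smooth_map_def Ck_map_bilinear)

lemmas smooth_map_mult = smooth_map_bilinear[OF bounded_bilinear_mult]
lemmas smooth_map_scaleR = smooth_map_bilinear[OF bounded_bilinear_scaleR]

lemma smooth_map_minus:
  fixes f :: "_ \<Rightarrow> real"
  shows "smooth_map f \<Longrightarrow> smooth_map (\<lambda>x. - f x)"
  using smooth_map_mult[OF smooth_map_const[of "-1"], of f] by simp

lemma smooth_map_diff:
  fixes f g :: "_ \<Rightarrow> real"
  shows "smooth_map f \<Longrightarrow> smooth_map g \<Longrightarrow> smooth_map (\<lambda>x. f x - g x)"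
  using smooth_map_add[OF _ smooth_map_minus[of g], of f] by simp

lemma smooth_map_sum:
  assumes "\<And>i. i \<in> I \<Longrightarrow> smooth_map (f i)"
  shows "smooth_map (\<lambda>x. \<Sum>i\<in>I. f i x)"
  using assms
proof (induction I rule: infinite_finite_induct)
  case (insert i I)
  then show ?case by (simp add: smooth_map_add)
qed (simp_all add: smooth_map_const)

lemma smooth_map_compose_real:
  fixes h :: "real \<Rightarrow> real"
  shows "smooth_map h \<Longrightarrow> smooth_map f \<Longrightarrow> smooth_map (\<lambda>x. h (f x))"
  by (simp add: smooth_map_def Ck_map_compose_real)

section \<open>Smoothness of the elementary functions\<close>

lemma Ck_map_exp: "Ck_map k (exp :: real \<Rightarrow> real)"
  by (induction k) (auto intro!: Ck_map_SucI_real DERIV_exp continuous_intros simp del: Ck_map.simps(2))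

lemma Ck_map_sin_cos: "Ck_map k (sin :: real \<Rightarrow> real) \<and> Ck_map k (cos :: real \<Rightarrow> real)"
proof (induction k)
  case 0
  then show ?case by (auto intro!: continuous_intros)
next
  case (Suc k)
  have "Ck_map k (\<lambda>x::real. (-1) * sin x)"
    by (intro Ck_map_bilinear[OF bounded_bilinear_mult] Ck_map_const) (use Suc in simp)
  then have "Ck_map (Suc k) (cos :: real \<Rightarrow> real)"
    by (intro Ck_map_SucI_real[OF DERIV_cos]) simp
  moreover have "Ck_map (Suc k) (sin :: real \<Rightarrow> real)"
    using Suc by (intro Ck_map_SucI_real[OF DERIV_sin]) simp
  ultimately show ?case by simp
qed

text \<open>This is the derivative of \<open>arctan\<close>. Its own derivative is
  \<open>-2 * x\<close> times its square, again a product of functions of class k, so the induction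
  closes up.\<close>

lemma Ck_map_inverse_1_plus_square: "Ck_map k (\<lambda>x::real. inverse (1 + x\<^sup>2))"
proof (induction k)
  case 0
  have "1 + x\<^sup>2 \<noteq> 0" for x :: real
    by (metis add.commute power2_eq_square sum_power2_eq_zero_iff power_one zero_neq_one)
  then show ?case by (auto intro!: continuous_intros)
next
  case (Suc k)
  let ?F = "\<lambda>x::real. inverse (1 + x\<^sup>2)"
  show ?case
  proof (rule Ck_map_SucI_real)
    show "(?F has_real_derivative ((-2) * x) * (?F x * ?F x)) (at x)" for x
    proof -
      have "1 + x\<^sup>2 \<noteq> 0"
        by (metis add.commute power2_eq_square sum_power2_eq_zero_iff power_one zero_neq_one)
      then show ?thesis
        by (auto intro!: derivative_eq_intros simp: power2_eq_square)
    qed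
    show "Ck_map k (\<lambda>x. ((-2) * x) * (?F x * ?F x))"
      by (intro Ck_map_bilinear[OF bounded_bilinear_mult] Suc Ck_map_const
          Ck_map_bounded_linear[OF bounded_linear_ident])
  qed
qed

lemma smooth_map_exp: "smooth_map (exp :: real \<Rightarrow> real)"
  and smooth_map_sin: "smooth_map (sin :: real \<Rightarrow> real)"
  and smooth_map_cos: "smooth_map (cos :: real \<Rightarrow> real)"
  by (simp_all add: smooth_map_def Ck_map_exp Ck_map_sin_cos)

lemma smooth_map_arctan: "smooth_map arctan"
  unfolding smooth_map_def
proof
  show "Ck_map k arctan" for k
    \<comment> \<open>The derivative being of class k, \<open>arctan\<close> is of class k + 1;
      dropping one order covers every k, including 0.\<close>
    using Ck_map_SucD[OF Ck_map_SucI_real[OF DERIV_arctan Ck_map_inverse_1_plus_square]] .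
qed

lemmas smooth_map_intros = smooth_map_const smooth_map_add smooth_map_mult smooth_map_scaleR
  smooth_map_minus smooth_map_diff smooth_map_sum smooth_map_compose_real[OF smooth_map_exp]
  smooth_map_compose_real[OF smooth_map_sin] smooth_map_compose_real[OF smooth_map_cos]
  smooth_map_compose_real[OF smooth_map_arctan]

section \<open>The isometry group\<close>

locale coordinates =
  fixes e :: "nat \<Rightarrow> 'n::finite" and lam :: "nat \<Rightarrow> real" and \<alpha> \<beta> :: real
  assumes bij_e: "bij_betw e {1..CARD('n)} UNIV"
    and card_ge: "CARD('n) \<ge> 4"
begin

abbreviation "g \<equiv> g_Rn e lam \<alpha> \<beta>"

lemma e_eq_iff: "i \<in> {1..CARD('n)} \<Longrightarrow> j \<in> {1..CARD('n)} \<Longrightarrow> e i = e j \<longleftrightarrow> i = j"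
  using bij_e by (meson bij_betw_def inj_on_eq_iff)

lemma e_distinct:
  "e 1 \<noteq> e 2" "e 2 \<noteq> e 1" "e 1 \<noteq> e CARD('n)" "e CARD('n) \<noteq> e 1" "e 2 \<noteq> e CARD('n)" "e CARD('n) \<noteq> e 2"
  using card_ge by (simp_all add: e_eq_iff)

text \<open>The last equation lets \<open>spiral\<close>, which is defined by cases on the index
  \<open>j\<close>, recover the number of a middle coordinate and with it the exponent
  \<open>lam i\<close>.\<close>

lemma e_middle:
  assumes "i \<in> {3..CARD('n) - 1}"
  shows "e i \<noteq> e 1" "e i \<noteq> e 2" "e i \<noteq> e CARD('n)" "inv_into {1..CARD('n)} e (e i) = i"
proof -
  show "e i \<noteq> e 1" "e i \<noteq> e 2" "e i \<noteq> e CARD('n)"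
    using assms card_ge by (subst e_eq_iff; auto)+
  show "inv_into {1..CARD('n)} e (e i) = i"
    using assms card_ge bij_e by (intro inv_into_f_f) (auto simp: bij_betw_def)
qed

lemma sum_split:
  fixes f :: "'n \<Rightarrow> real"
  shows "sum f UNIV = f (e 1) + f (e 2) + (\<Sum>i = 3..CARD('n) - 1. f (e i)) + f (e CARD('n))"
proof -
  have "sum f UNIV = (\<Sum>i\<in>{1..CARD('n)}. f (e i))"
    using sum.reindex_bij_betw[OF bij_e] by metis
  also have "{1..CARD('n)} = {1, 2} \<union> {3..CARD('n) - 1} \<union> {CARD('n)}"
    using card_ge by auto
  also have "(\<Sum>i\<in>\<dots>. f (e i)) = f (e 1) + f (e 2) + (\<Sum>i = 3..CARD('n) - 1. f (e i)) + f (e CARD('n))"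
    using card_ge by (subst sum.union_disjoint; auto)+
  finally show ?thesis .
qed

text \<open>In the coordinate \<open>e CARD('n)\<close> this linear part is the identity; the shift by \<open>s\<close> is supplied
  by the translation part of the isometry.\<close>

definition spiral :: "real \<Rightarrow> real ^ 'n \<Rightarrow> real ^ 'n" where
  "spiral s x = (\<chi> j.
     if j = e 1 then exp (\<alpha> * s) * (cos (\<beta> * s) * x $ e 1 - sin (\<beta> * s) * x $ e 2)
     else if j = e 2 then exp (\<alpha> * s) * (sin (\<beta> * s) * x $ e 1 + cos (\<beta> * s) * x $ e 2)
     else if j = e CARD('n) then x $ j
     else exp (lam (inv_into {1..CARD('n)} e j) * s) * x $ j)"

lemma spiral_nth:
  "spiral s x $ e 1 = exp (\<alpha> * s) * (cos (\<beta> * s) * x $ e 1 - sin (\<beta> * s) * x $ e 2)"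
  "spiral s x $ e 2 = exp (\<alpha> * s) * (sin (\<beta> * s) * x $ e 1 + cos (\<beta> * s) * x $ e 2)"
  "spiral s x $ e CARD('n) = x $ e CARD('n)"
  "i \<in> {3..CARD('n) - 1} \<Longrightarrow> spiral s x $ e i = exp (lam i * s) * x $ e i"
  using e_distinct e_middle by (auto simp: spiral_def)

lemma linear_spiral: "linear (spiral s)"
  by (rule linearI) (auto simp: spiral_def vec_eq_iff algebra_simps)

lemma bounded_linear_spiral: "bounded_linear (spiral s)"
  by (simp add: linear_spiral linear_conv_bounded_linear[symmetric])

lemma vec_eq_coordinates:
  fixes x y :: "real ^ 'n"
  assumes "x $ e 1 = y $ e 1" "x $ e 2 = y $ e 2" "x $ e CARD('n) = y $ e CARD('n)"
    and "\<And>i. i \<in> {3..CARD('n) - 1} \<Longrightarrow> x $ e i = y $ e i"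
  shows "x = y"
proof -
  have "x $ e i = y $ e i" if "i \<in> {1..CARD('n)}" for i
  proof -
    have "i = 1 \<or> i = 2 \<or> i = CARD('n) \<or> i \<in> {3..CARD('n) - 1}" using that by auto
    then show ?thesis using assms by auto
  qed
  moreover have "\<exists>i\<in>{1..CARD('n)}. j = e i" for j
    using bij_e by (auto simp: bij_betw_def)
  ultimately show ?thesis by (metis vec_eq_iff)
qed

text \<open>On the plane the map is complex multiplication by e^((\<alpha> + i\<beta>)s), and on the
  middle coordinates it is a real exponential, so negating \<open>s\<close> inverts it. The planar
  expressions are factored to expose \<open>E\<close> and \<open>P\<close>.\<close>

lemma spiral_inverse: "spiral s (spiral (- s) x) = x"
proof (rule vec_eq_coordinates)
  have E: "exp (\<alpha> * s) * exp (- (\<alpha> * s)) = 1"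
    by (simp add: exp_minus)
  have P: "cos (\<beta> * s) * cos (\<beta> * s) + sin (\<beta> * s) * sin (\<beta> * s) = 1"
    by (metis add.commute sin_cos_squared_add3)
  have "spiral s (spiral (- s) x) $ e 1
      = (exp (\<alpha> * s) * exp (- (\<alpha> * s)))
        * ((cos (\<beta> * s) * cos (\<beta> * s) + sin (\<beta> * s) * sin (\<beta> * s)) * x $ e 1)"
    unfolding spiral_nth mult_minus_right cos_minus sin_minus by algebra
  then show "spiral s (spiral (- s) x) $ e 1 = x $ e 1"
    unfolding E P mult_1 .
  have "spiral s (spiral (- s) x) $ e 2
      = (exp (\<alpha> * s) * exp (- (\<alpha> * s)))
        * ((cos (\<beta> * s) * cos (\<beta> * s) + sin (\<beta> * s) * sin (\<beta> * s)) * x $ e 2)"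
    unfolding spiral_nth mult_minus_right cos_minus sin_minus by algebra
  then show "spiral s (spiral (- s) x) $ e 2 = x $ e 2"
    unfolding E P mult_1 .
qed (simp_all add: spiral_nth exp_minus)

text \<open>The metric at a point depends only on the last coordinate t. Replacing t by t + s
  multiplies the coefficient e^(-2(\<alpha> + i\<beta>)t) by e^(-2(\<alpha> + i\<beta>)s), which
  cancels the factor e^((\<alpha> + i\<beta>)s) acquired by each of the two vectors. The middle
  terms cancel in the same way.\<close>

lemma g_spiral:
  assumes "y $ e CARD('n) = x $ e CARD('n) + s"
  shows "g y (spiral s u) (spiral s v) = g x u v"
proof -
  let ?t = "x $ e CARD('n)"
  have lam: "exp (-2 * lam i * (?t + s)) * ((exp (lam i * s) * a) * (exp (lam i * s) * b))
      = exp (-2 * lam i * ?t) * (a * b)" for i a b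
  proof -
    have "exp (-2 * lam i * (?t + s)) * (exp (lam i * s) * exp (lam i * s)) = exp (-2 * lam i * ?t)"
      by (simp add: exp_add[symmetric] algebra_simps)
    then show ?thesis by (metis mult.assoc mult.left_commute)
  qed
  have \<alpha>: "exp (-2 * \<alpha> * (?t + s)) * (exp (\<alpha> * s) * exp (\<alpha> * s)) = exp (-2 * \<alpha> * ?t)"
    by (simp add: exp_add[symmetric] algebra_simps)
  define C S where "C = cos (\<beta> * s)" and "S = sin (\<beta> * s)"
  have CS: "S * S + C * C = 1"
    unfolding C_def S_def by (metis add.commute sin_cos_squared_add3)
  define c d where "c = cos (2 * \<beta> * ?t)" and "d = sin (2 * \<beta> * ?t)"
  have ts: "2 * \<beta> * (?t + s) = 2 * \<beta> * ?t + 2 * (\<beta> * s)"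
    by (simp add: algebra_simps)
  have ct: "cos (2 * \<beta> * (?t + s)) = c * (C * C - S * S) - d * (2 * S * C)"
    unfolding ts cos_add cos_double sin_double c_def d_def C_def S_def
    by (simp add: power2_eq_square)
  have st: "sin (2 * \<beta> * (?t + s)) = d * (C * C - S * S) + c * (2 * S * C)"
    unfolding ts sin_add cos_double sin_double c_def d_def C_def S_def
    by (simp add: power2_eq_square)
  \<comment> \<open>Rotating both vectors by the angle \<beta>s turns the phase of the planar form
    by 2\<beta>s, which undoes the shift recorded in \<open>ct\<close> and
    \<open>st\<close>.\<close>
  have rot: "(c * (C * C - S * S) - d * (2 * S * C))
        * (- ((C * a - S * b) * (C * a' - S * b')) + (S * a + C * b) * (S * a' + C * b'))
      - (d * (C * C - S * S) + c * (2 * S * C))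
        * ((C * a - S * b) * (S * a' + C * b') + (S * a + C * b) * (C * a' - S * b'))
      = c * (- (a * a') + b * b') - d * (a * b' + b * a')" for a b a' b'
    using CS by algebra
  have plane: "exp (-2 * \<alpha> * (?t + s)) *
      (cos (2 * \<beta> * (?t + s)) * (- ((exp (\<alpha> * s) * (C * a - S * b)) * (exp (\<alpha> * s) * (C * a' - S * b')))
          + (exp (\<alpha> * s) * (S * a + C * b)) * (exp (\<alpha> * s) * (S * a' + C * b')))
        - sin (2 * \<beta> * (?t + s)) * ((exp (\<alpha> * s) * (C * a - S * b)) * (exp (\<alpha> * s) * (S * a' + C * b'))
          + (exp (\<alpha> * s) * (S * a + C * b)) * (exp (\<alpha> * s) * (C * a' - S * b'))))
      = exp (-2 * \<alpha> * ?t) * (c * (- (a * a') + b * b') - d * (a * b' + b * a'))"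
      (is "?lhs = _") for a b a' b'
  proof -
    have "?lhs = (exp (-2 * \<alpha> * (?t + s)) * (exp (\<alpha> * s) * exp (\<alpha> * s))) *
      ((c * (C * C - S * S) - d * (2 * S * C))
        * (- ((C * a - S * b) * (C * a' - S * b')) + (S * a + C * b) * (S * a' + C * b'))
      - (d * (C * C - S * S) + c * (2 * S * C))
        * ((C * a - S * b) * (S * a' + C * b') + (S * a + C * b) * (C * a' - S * b')))"
      unfolding ct st by algebra
    then show ?thesis unfolding \<alpha> rot .
  qed
  have "(\<Sum>i = 3..CARD('n) - 1. exp (-2 * lam i * (?t + s)) * (spiral s u $ e i * spiral s v $ e i))
      = (\<Sum>i = 3..CARD('n) - 1. exp (-2 * lam i * ?t) * (u $ e i * v $ e i))"
    by (rule sum.cong) (simp_all only: spiral_nth lam)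
  then show ?thesis
    using plane[of "u $ e 1" "u $ e 2" "v $ e 1" "v $ e 2"]
    unfolding g_Rn_def Let_def assms spiral_nth C_def[symmetric] S_def[symmetric]
      c_def[symmetric] d_def[symmetric] by simp
qed

text \<open>The linear part fixes the last coordinate, so the translations alone shift it, by
  exactly \<open>s\<close>. This is the hypothesis of \<open>g_spiral\<close>, and the derivative is
  \<open>spiral s\<close> everywhere.\<close>

lemma metric_isometry_spiral:
  fixes p q :: "real ^ 'n"
  defines "s \<equiv> q $ e CARD('n) - p $ e CARD('n)"
  shows "metric_isometry g (\<lambda>x. spiral s (x - p) + q)"
proof -
  let ?\<phi> = "\<lambda>x. spiral s (x - p) + q" and ?\<psi> = "\<lambda>y. spiral (- s) (y - q) + p"
  have affine: "smooth_map (\<lambda>x. spiral r (x - a) + b)" for r and a b :: "real ^ 'n"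
  proof -
    have "smooth_map (\<lambda>x. spiral r x + (b - spiral r a))"
      by (intro smooth_map_intros smooth_map_bounded_linear bounded_linear_spiral)
    then show ?thesis by (simp add: linear_diff[OF linear_spiral] algebra_simps)
  qed
  have \<phi>\<psi>: "?\<phi> (?\<psi> y) = y" for y
    using spiral_inverse[of s] by simp
  have \<psi>\<phi>: "?\<psi> (?\<phi> x) = x" for x
    using spiral_inverse[of "- s"] by simp
  have inv: "inv ?\<phi> = ?\<psi>"
    by (rule inv_unique_comp) (simp_all only: fun_eq_iff o_def id_apply simp_thms \<phi>\<psi> \<psi>\<phi>)
  have "bij ?\<phi>"
    by (rule o_bij[of ?\<psi>]) (simp_all only: fun_eq_iff o_def id_apply simp_thms \<phi>\<psi> \<psi>\<phi>)
  moreover have "frechet_derivative ?\<phi> (at x) = spiral s" for x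
  proof -
    have "(?\<phi> has_derivative spiral s) (at x)"
      by (auto intro!: derivative_eq_intros bounded_linear.has_derivative[OF bounded_linear_spiral])
    then show ?thesis by (metis frechet_derivative_at)
  qed
  moreover have "?\<phi> x $ e CARD('n) = x $ e CARD('n) + s" for x
    by (simp add: spiral_nth s_def)
  ultimately show ?thesis
    unfolding metric_isometry_def inv by (simp add: affine g_spiral)
qed

lemma homogeneous: "homogeneous_metric g"
  unfolding homogeneous_metric_def
proof (intro allI)
  fix p q :: "real ^ 'n"
  have "spiral s (p - p) + q = q" for s
    by (simp add: linear_0[OF linear_spiral])
  then show "\<exists>\<phi>. metric_isometry g \<phi> \<and> \<phi> p = q"
    using metric_isometry_spiral[where p = p and q = q] by blast
qed

text \<open>At the origin all exponentials and the cosine are 1 and the sine is 0, which leaves the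
  Minkowski form with \<open>e 1\<close> as time direction.\<close>

lemma g_at_origin: "g 0 u v = (\<Sum>j\<in>UNIV. (if j = e 1 then -1 else 1) * (u $ j * v $ j))"
proof -
  have "(\<Sum>i = 3..CARD('n) - 1. (if e i = e 1 then -1 else 1) * (u $ e i * v $ e i))
      = (\<Sum>i = 3..CARD('n) - 1. u $ e i * v $ e i)"
    by (rule sum.cong) (simp_all only: e_middle if_False mult_1 refl)
  then show ?thesis
    unfolding sum_split g_Rn_def Let_def by (simp only: e_distinct if_True if_False) simp
qed

lemma lorentzian: "lorentzian_metric g"
  unfolding lorentzian_metric_def
proof (intro conjI allI)
  show "smooth_map (\<lambda>x. g x u v)" for u v
    unfolding g_Rn_def Let_def
    by (intro smooth_map_intros smooth_map_bounded_linear bounded_linear_vec_nth)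
  show "bilinear (g x)" for x
    unfolding bilinear_def
    by (auto intro!: linearI simp: g_Rn_def Let_def algebra_simps sum.distrib sum_distrib_left)
  show "g x u v = g x v u" for x u v
    by (simp add: g_Rn_def mult.commute add.commute)
  show "\<exists>(b :: 'n \<Rightarrow> real ^ 'n) i\<^sub>0. \<forall>i j.
        g x (b i) (b j) = (if i = j then (if i = i\<^sub>0 then -1 else 1) else 0)" for x
  proof (intro exI allI)
    fix i j
    \<comment> \<open>The frame at \<open>x\<close> is the standard basis at the origin carried to
      the level of \<open>x\<close> by the linear part of an isometry; the timelike index is
      \<open>e 1\<close>.\<close>
    have "g x (spiral (x $ e CARD('n)) (axis i 1)) (spiral (x $ e CARD('n)) (axis j 1))
        = g 0 (axis i 1) (axis j 1)"
      by (rule g_spiral) simp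
    also have "\<dots> = (\<Sum>k\<in>UNIV. if k = i then (if i = j then (if i = e 1 then -1 else 1) else 0) else 0)"
      unfolding g_at_origin by (rule sum.cong) (auto simp: axis_def)
    also have "\<dots> = (if i = j then (if i = e 1 then -1 else 1) else 0)"
      by simp
    finally show "g x (spiral (x $ e CARD('n)) (axis i 1)) (spiral (x $ e CARD('n)) (axis j 1))
        = (if i = j then (if i = e 1 then -1 else 1) else 0)" .
  qed
qed

section \<open>The closed timelike curve\<close>

text \<open>The planar part is a primitive of k(1 + iw)^2 with w = sqrt 2 cos s: the real part 1 -
  w^2 = -cos 2s integrates to -sin s cos s, the imaginary part 2w to 2 sqrt 2 sin s. The amplitude
  sqrt 2 gives w^2 the mean value 1, so that no linear drift remains. The last coordinate t solves
  tan(\<beta>t/2) = w.\<close>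

definition fig8 :: "real \<Rightarrow> real \<Rightarrow> real ^ 'n" where
  "fig8 k s = (- k * (sin s * cos s)) *\<^sub>R axis (e 1) 1 + (2 * sqrt 2 * k * sin s) *\<^sub>R axis (e 2) 1
     + (2 / \<beta> * arctan (sqrt 2 * cos s)) *\<^sub>R axis (e CARD('n)) 1"

definition fig8' :: "real \<Rightarrow> real \<Rightarrow> real ^ 'n" where
  "fig8' k s = (k * (1 - 2 * (cos s)\<^sup>2)) *\<^sub>R axis (e 1) 1
     + (2 * sqrt 2 * k * cos s) *\<^sub>R axis (e 2) 1
     + (- (2 / \<beta>) * sqrt 2 * sin s / (1 + 2 * (cos s)\<^sup>2)) *\<^sub>R axis (e CARD('n)) 1"

lemma smooth_fig8: "smooth_map (fig8 k)"
  unfolding fig8_def by (intro smooth_map_intros smooth_map_sin smooth_map_cos)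

lemma fig8_derivative: "(fig8 k has_vector_derivative fig8' k s) (at s)"
proof -
  have scale: "((\<lambda>s. f s *\<^sub>R v) has_vector_derivative f' *\<^sub>R v) (at s)"
    if "(f has_real_derivative f') (at s)" for f f' and v :: "real ^ 'n"
    using has_vector_derivative_scaleR[OF that has_vector_derivative_const[of v]] by simp
  have "((\<lambda>s. - k * (sin s * cos s)) has_real_derivative k * (1 - 2 * (cos s)\<^sup>2)) (at s)"
  proof -
    have "- k * (cos s * cos s - sin s * sin s) = k * (1 - 2 * (cos s)\<^sup>2)"
      using sin_cos_squared_add3[of s] by algebra
    then show ?thesis by (auto intro!: derivative_eq_intros simp: algebra_simps)
  qed
  moreover have "((\<lambda>s. 2 * sqrt 2 * k * sin s) has_real_derivative 2 * sqrt 2 * k * cos s) (at s)"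
    by (auto intro!: derivative_eq_intros)
  moreover have "((\<lambda>s. r * arctan (sqrt 2 * cos s)) has_real_derivative
      - r * sqrt 2 * sin s / (1 + 2 * (cos s)\<^sup>2)) (at s)" for r
    by (auto intro!: derivative_eq_intros simp: power_mult_distrib field_simps)
  ultimately show ?thesis
    unfolding fig8_def fig8'_def by (intro has_vector_derivative_add scale)
qed

text \<open>These are the real and imaginary parts of (1 + iw)^4 = (1 + w^2)^2 e^(4i arctan w),
  since 1 + iw has argument arctan w. On the curve 4 arctan w is the phase 2\<beta>t of the metric.
  The form without division suits \<open>algebra\<close>.\<close>

lemma cos_sin_four_arctan:
  "cos (4 * arctan w) * (1 + w\<^sup>2)\<^sup>2 = (1 - w\<^sup>2)\<^sup>2 - 4 * w\<^sup>2"
  "sin (4 * arctan w) * (1 + w\<^sup>2)\<^sup>2 = 4 * w * (1 - w\<^sup>2)"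
proof -
  define C S where "C = cos (arctan w)" and "S = sin (arctan w)"
  have "C \<noteq> 0" by (simp add: C_def)
  have "w = S / C"
    unfolding C_def S_def by (metis tan_arctan tan_def)
  then have S: "S = w * C" using \<open>C \<noteq> 0\<close> by simp
  have 1: "(1 + w\<^sup>2) * C\<^sup>2 = 1"
    using sin_cos_squared_add[of "arctan w"] unfolding C_def[symmetric] S_def[symmetric] S
    by (simp add: algebra_simps power_mult_distrib)
  have c2: "cos (2 * arctan w) = (1 - w\<^sup>2) * C\<^sup>2"
    unfolding cos_double C_def[symmetric] S_def[symmetric] S
    by (simp add: algebra_simps power_mult_distrib)
  have s2: "sin (2 * arctan w) = 2 * w * C\<^sup>2"
    unfolding sin_double C_def[symmetric] S_def[symmetric] S by (simp add: power2_eq_square)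
  have 4: "4 * arctan w = 2 * (2 * arctan w)" by simp
  show "cos (4 * arctan w) * (1 + w\<^sup>2)\<^sup>2 = (1 - w\<^sup>2)\<^sup>2 - 4 * w\<^sup>2"
    unfolding 4 cos_double[of "2 * arctan w"] c2 s2 using 1 by algebra
  show "sin (4 * arctan w) * (1 + w\<^sup>2)\<^sup>2 = 4 * w * (1 - w\<^sup>2)"
    unfolding 4 sin_double[of "2 * arctan w"] c2 s2 using 1 by algebra
qed

text \<open>The planar velocity k(1 + iw)^2 has, up to the sign of k, the argument 2 arctan w =
  \<beta>t. Its square therefore cancels the phase of the metric, and the planar term is minus the
  squared modulus times the exponential factor.\<close>

lemma g_fig8:
  assumes "\<beta> > 0"
  defines "w \<equiv> \<lambda>s. sqrt 2 * cos s"
  shows "g (fig8 k s) (fig8' k s) (fig8' k s) =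
    (2 / \<beta> * sqrt 2 * sin s / (1 + (w s)\<^sup>2))\<^sup>2
    - exp (- 4 * \<alpha> / \<beta> * arctan (w s)) * (k * (1 + (w s)\<^sup>2))\<^sup>2"
proof -
  have w2: "2 * (cos s)\<^sup>2 = (w s)\<^sup>2" by (simp add: w_def power_mult_distrib)
  have coords: "fig8 k s $ e CARD('n) = 2 / \<beta> * arctan (w s)"
    "fig8' k s $ e 1 = k * (1 - (w s)\<^sup>2)" "fig8' k s $ e 2 = k * (2 * w s)"
    "fig8' k s $ e CARD('n) = - (2 / \<beta> * sqrt 2 * sin s / (1 + (w s)\<^sup>2))"
    using e_distinct unfolding fig8_def fig8'_def w2 by (auto simp: axis_def w_def)
  have middle: "fig8' k s $ e i = 0" if "i \<in> {3..CARD('n) - 1}" for i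
    using e_middle[OF that] by (auto simp: fig8'_def axis_def)
  have "(\<Sum>i = 3..CARD('n) - 1. exp (-2 * lam i * fig8 k s $ e CARD('n)) * (fig8' k s $ e i)\<^sup>2) = 0"
    by (rule sum.neutral) (simp add: middle)
  moreover have "cos (4 * arctan (w s)) * (- (k * (1 - (w s)\<^sup>2))\<^sup>2 + (k * (2 * w s))\<^sup>2)
      - 2 * sin (4 * arctan (w s)) * (k * (1 - (w s)\<^sup>2)) * (k * (2 * w s)) = - (k * (1 + (w s)\<^sup>2))\<^sup>2"
  proof -
    \<comment> \<open>By \<open>cos_sin_four_arctan\<close> the left-hand side is -(k(1 + w^2))^2
      times this sum of squares.\<close>
    have "(cos (4 * arctan (w s)))\<^sup>2 + (sin (4 * arctan (w s)))\<^sup>2 = 1" by simp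
    then show ?thesis
      using cos_sin_four_arctan[of "w s"] by algebra
  qed
  moreover have "2 * \<beta> * (2 / \<beta> * arctan (w s)) = 4 * arctan (w s)"
    "-2 * \<alpha> * (2 / \<beta> * arctan (w s)) = - 4 * \<alpha> / \<beta> * arctan (w s)"
    using assms(1) by simp_all
  ultimately show ?thesis
    unfolding g_Rn_line_element[OF refl] coords by simp
qed

text \<open>The vertical speed is bounded and the exponential factor is bounded below, both
  uniformly in s, because arctan is bounded. A large multiple of the planar velocity thus
  dominates.\<close>

lemma fig8_timelike:
  assumes "\<beta> > 0"
  obtains k where "\<And>s. g (fig8 k s) (fig8' k s) (fig8' k s) < 0"
proof
  fix s
  \<comment> \<open>\<open>K\<close> solves exp(-2|\<alpha>| pi/\<beta>) K^2 = (4/\<beta>)^2,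
    balancing the lower bound of the exponential factor against the bound 4/\<beta> of the vertical
    speed. It does not involve \<open>s\<close>.\<close>
  define K where "K = 4 / \<beta> * exp (\<bar>\<alpha>\<bar> * pi / \<beta>)"
  define w where "w = sqrt 2 * cos s"
  have shrink: "x / y \<le> x" if "x \<ge> 0" "y \<ge> 1" for x y :: real
    using that by (simp add: divide_le_eq mult_le_cancel_left1)
  have w1: "1 + w\<^sup>2 \<ge> 1" by simp
  have "\<bar>2 / \<beta> * sqrt 2 * sin s / (1 + w\<^sup>2)\<bar> = \<bar>2 / \<beta> * sqrt 2 * sin s\<bar> / (1 + w\<^sup>2)"
    using w1 by (subst abs_divide) simp
  also have "\<dots> \<le> \<bar>2 / \<beta> * sqrt 2 * sin s\<bar>"
    by (rule shrink[OF abs_ge_zero w1])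
  also have "\<dots> = 2 / \<beta> * sqrt 2 * \<bar>sin s\<bar>"
    using assms by (simp add: abs_mult)
  also have "\<dots> \<le> 2 / \<beta> * sqrt 2 * 1"
    using assms by (intro mult_left_mono) auto
  \<comment> \<open>Rounding sqrt 2 up to 2 provides the strictness of the final inequality.\<close>
  also have "\<dots> < 4 / \<beta>"
    using assms sqrt2_less_2 by (simp add: divide_strict_right_mono)
  finally have lhs: "\<bar>2 / \<beta> * sqrt 2 * sin s / (1 + w\<^sup>2)\<bar> < 4 / \<beta>" .
  have "\<bar>arctan w\<bar> \<le> pi / 2"
    using arctan_bounded[of w] by (auto simp: abs_le_iff)
  then have "\<bar>4 * \<alpha> / \<beta> * arctan w\<bar> \<le> 4 * \<bar>\<alpha>\<bar> / \<beta> * (pi / 2)"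
    using assms unfolding abs_mult by (intro mult_mono) auto
  then have "4 * \<alpha> / \<beta> * arctan w \<le> 4 * \<bar>\<alpha>\<bar> / \<beta> * (pi / 2)"
    by (rule order_trans[OF abs_ge_self])
  then have ex: "exp (- (2 * \<bar>\<alpha>\<bar> * pi / \<beta>)) \<le> exp (- 4 * \<alpha> / \<beta> * arctan w)"
    by (simp add: mult_ac)
  have "\<bar>2 / \<beta> * sqrt 2 * sin s / (1 + w\<^sup>2)\<bar>\<^sup>2 < (4 / \<beta>)\<^sup>2"
    using lhs by (intro power_strict_mono) auto
  then have "(2 / \<beta> * sqrt 2 * sin s / (1 + w\<^sup>2))\<^sup>2 < (4 / \<beta>)\<^sup>2"
    unfolding power2_abs .
  also have "(4 / \<beta>)\<^sup>2 = exp (- (2 * \<bar>\<alpha>\<bar> * pi / \<beta>)) * K\<^sup>2"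
  proof -
    have "exp (2 * \<bar>\<alpha>\<bar> * pi / \<beta>) = (exp (\<bar>\<alpha>\<bar> * pi / \<beta>))\<^sup>2"
      unfolding exp_double[symmetric] by (simp add: mult_ac)
    then show ?thesis
      by (simp add: K_def exp_minus power_mult_distrib power_divide)
  qed
  also have "\<dots> \<le> exp (- 4 * \<alpha> / \<beta> * arctan w) * (K * (1 + w\<^sup>2))\<^sup>2"
  proof (intro mult_mono ex power_mono)
    show "K \<le> K * (1 + w\<^sup>2)" using mult_left_mono[OF w1, of K] assms by (simp add: K_def)
  qed (use assms in \<open>auto simp: K_def\<close>)
  finally show "g (fig8 K s) (fig8' K s) (fig8' K s) < 0"
    unfolding g_fig8[OF assms] w_def by simp
qed

lemma totally_vicious:
  assumes "\<beta> > 0"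
  shows "totally_vicious g"
  unfolding totally_vicious_def
proof
  fix p :: "real ^ 'n"
  obtain k where k: "\<And>s. g (fig8 k s) (fig8' k s) (fig8' k s) < 0"
    using fig8_timelike[OF assms] by blast
  define q where "q = fig8 k 0"
  define s where "s = p $ e CARD('n) - q $ e CARD('n)"
  \<comment> \<open>This is the image of the figure eight under the isometry taking \<open>q\<close>
    to \<open>p\<close>, with the linear part multiplied out.\<close>
  define c where "c = (\<lambda>t. spiral s (fig8 k t) + (p - spiral s q))"
  have c': "vector_derivative c (at t) = spiral s (fig8' k t)" for t
  proof (rule vector_derivative_at)
    show "(c has_vector_derivative spiral s (fig8' k t)) (at t)"
      unfolding c_def
      by (auto intro!: derivative_eq_intros fig8_derivative
          bounded_linear.has_vector_derivative[OF bounded_linear_spiral])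
  qed
  have cN: "c t $ e CARD('n) = fig8 k t $ e CARD('n) + s" for t
    by (simp add: c_def spiral_nth s_def)
  have "smooth_map c"
  proof -
    \<comment> \<open>Linearity of \<open>spiral s\<close> makes the curve a combination of constant
      vectors with smooth real coefficients, to which the closure rules apply.\<close>
    have "c = (\<lambda>t. (- k * (sin t * cos t)) *\<^sub>R spiral s (axis (e 1) 1)
        + (2 * sqrt 2 * k * sin t) *\<^sub>R spiral s (axis (e 2) 1)
        + (2 / \<beta> * arctan (sqrt 2 * cos t)) *\<^sub>R spiral s (axis (e CARD('n)) 1) + (p - spiral s q))"
      unfolding c_def fig8_def by (simp only: linear_add[OF linear_spiral] linear_cmul[OF linear_spiral])
    then show ?thesis
      by (simp only:) (intro smooth_map_intros smooth_map_sin smooth_map_cos)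
  qed
  moreover have "c (t + 2 * pi) = c t" for t
    by (simp add: c_def fig8_def)
  moreover have "g (c t) (vector_derivative c (at t)) (vector_derivative c (at t)) < 0" for t
    unfolding c' g_spiral[OF cN] by (rule k)
  moreover have "p = c 0"
    by (simp add: c_def q_def)
  ultimately show "\<exists>c. closed_timelike_curve g c \<and> p \<in> range c"
    unfolding closed_timelike_curve_def
    by (intro exI[of _ c] conjI exI[of _ "2 * pi"]) auto
qed

end

theorem proposition5p2:
  fixes e :: "nat \<Rightarrow> 'n::finite" and n :: nat and lam :: "nat \<Rightarrow> real" and \<alpha> \<beta> :: real
  assumes "n = CARD('n)" and "n \<ge> 4"
    and "bij_betw e {1..n} (UNIV :: 'n set)"
    and "\<alpha> \<le> 0" and "\<beta> > 0"
  shows "lorentzian_metric (g_Rn e lam \<alpha> \<beta>) \<and>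
         homogeneous_metric (g_Rn e lam \<alpha> \<beta>) \<and>
         totally_vicious (g_Rn e lam \<alpha> \<beta>)"
proof -
  interpret coordinates e lam \<alpha> \<beta>
    using assms by unfold_locales auto
  show ?thesis
    using lorentzian homogeneous totally_vicious[OF assms(5)] by blast
qed

end
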